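(* The logic $\mathbf{GL}$ enjoys the uniform Lyndon interpolation property. Moreover, for any formula $\varphi$ and any finite sets $P,Q$ of propositional variables there exists a uniform Lyndon interpolant $\theta$ of $(\varphi,P,Q)$ in $\mathbf{GL}$ with $d(\theta)\le 3n(\varphi)+3$.
   Context: Formulas are built from countably many propositional variables, $\bot$, $\to$ and $\Box$ (other connectives are abbreviations). Modal depth: $d(p)=d(\bot)=0$, $d(\varphi\to\psi)=\max\{d(\varphi),d(\psi)\}$, $d(\Box\varphi)=d(\varphi)+1$. Positive/negative variable sets: $v^+(p)=\{p\}$, $v^-(p)=\emptyset$; $v^\pm(\bot)=\emptyset$; $v^+(\psi\to\theta)=v^-(\psi)\cup v^+(\theta)$, $v^-(\psi\to\theta)=v^+(\psi)\cup v^-(\theta)$; $v^\pm(\Box\psi)=v^\pm(\psi)$. $\mathrm{Sub}(\varphi)$ is the set of subformulas of $\varphi$ and $n(\varphi)=|\{\psi:\Box\psi\in\mathrm{Sub}(\varphi)\}|$. A normal logic is a set of formulas containing all tautologies and $\Box(p\to q)\to(\Box p\to\Box q)$, closed under modus ponens, necessitation and uniform substitution; $L\vdash\varphi$ means $\varphi\in L$. $\mathbf{GL}$ is the least normal logic containing $\Box(\Box p\to p)\to\Box p$. For a normal logic $L$, formula $\varphi$ and finite sets $P,Q$ of variables, a uniform Lyndon interpolant of $(\varphi,P,Q)$ in $L$ is a formula $\theta$ with $v^+(\theta)\subseteq v^+(\varphi)\setminus P$, $v^-(\theta)\subseteq v^-(\varphi)\setminus Q$, $L\vdash\varphi\to\theta$,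 and such that $L\vdash\theta\to\psi$ for every $\psi$ with $v^+(\psi)\cap P=v^-(\psi)\cap Q=\emptyset$ and $L\vdash\varphi\to\psi$. $L$ enjoys the uniform Lyndon interpolation property if such an interpolant exists for all $\varphi,P,Q$. *)

theory Defs
  imports Main
begin

datatype form = Var nat | Bot | Imp form form (infixr "\<rightarrow>\<^sub>f" 55) | Box form

fun depth :: "form \<Rightarrow> nat" where
  "depth (Var p) = 0"
| "depth Bot = 0"
| "depth (Imp \<phi> \<psi>) = max (depth \<phi>) (depth \<psi>)"
| "depth (Box \<phi>) = depth \<phi> + 1"

fun vpos :: "form \<Rightarrow> nat set" and vneg :: "form \<Rightarrow> nat set" where
  "vpos (Var p) = {p}"
| "vpos Bot = {}"
| "vpos (Imp \<psi> \<theta>) = vneg \<psi> \<union> vpos \<theta>"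
| "vpos (Box \<psi>) = vpos \<psi>"
| "vneg (Var p) = {}"
| "vneg Bot = {}"
| "vneg (Imp \<psi> \<theta>) = vpos \<psi> \<union> vneg \<theta>"
| "vneg (Box \<psi>) = vneg \<psi>"

fun Sub :: "form \<Rightarrow> form set" where
  "Sub (Var p) = {Var p}"
| "Sub Bot = {Bot}"
| "Sub (Imp \<phi> \<psi>) = {Imp \<phi> \<psi>} \<union> Sub \<phi> \<union> Sub \<psi>"
| "Sub (Box \<phi>) = {Box \<phi>} \<union> Sub \<phi>"

definition nbox :: "form \<Rightarrow> nat" where
  "nbox \<phi> = card {\<psi>. Box \<psi> \<in> Sub \<phi>}"

lemma finite_Sub: "finite (Sub \<phi>)"
  by (induction \<phi>) auto

lemma finite_boxed_Sub: "finite {\<psi>. Box \<psi> \<in> Sub \<phi>}"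
  by (rule finite_vimageI[OF finite_Sub, of Box, unfolded vimage_def]) (simp add: inj_def)

fun subst :: "(nat \<Rightarrow> form) \<Rightarrow> form \<Rightarrow> form" where
  "subst \<sigma> (Var p) = \<sigma> p"
| "subst \<sigma> Bot = Bot"
| "subst \<sigma> (Imp \<phi> \<psi>) = Imp (subst \<sigma> \<phi>) (subst \<sigma> \<psi>)"
| "subst \<sigma> (Box \<phi>) = Box (subst \<sigma> \<phi>)"

text \<open>Boolean evaluation in which variables (valued by \<open>g\<close>) and boxed formulas (valued by
  \<open>h\<close>) are the atoms, so the tautologies are the substitution instances of
  classical propositional tautologies.\<close>

fun bool_eval :: "(nat \<Rightarrow> bool) \<Rightarrow> (form \<Rightarrow> bool) \<Rightarrow> form \<Rightarrow> bool" where
  "bool_eval g h (Var p) = g p"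
| "bool_eval g h Bot = False"
| "bool_eval g h (Imp \<phi> \<psi>) = (bool_eval g h \<phi> \<longrightarrow> bool_eval g h \<psi>)"
| "bool_eval g h (Box \<phi>) = h \<phi>"

definition tautology :: "form \<Rightarrow> bool" where
  "tautology \<phi> \<longleftrightarrow> (\<forall>g h. bool_eval g h \<phi>)"

definition axiom_K :: form where
  "axiom_K = Box (Var 0 \<rightarrow>\<^sub>f Var 1) \<rightarrow>\<^sub>f (Box (Var 0) \<rightarrow>\<^sub>f Box (Var 1))"

definition axiom_Loeb :: form where
  "axiom_Loeb = Box (Box (Var 0) \<rightarrow>\<^sub>f Var 0) \<rightarrow>\<^sub>f Box (Var 0)"

definition normal_logic :: "form set \<Rightarrow> bool" where
  "normal_logic L \<longleftrightarrow>
     (\<forall>\<phi>. tautology \<phi> \<longrightarrow> \<phi> \<in> L) \<and>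
     axiom_K \<in> L \<and>
     (\<forall>\<phi> \<psi>. (\<phi> \<rightarrow>\<^sub>f \<psi>) \<in> L \<longrightarrow> \<phi> \<in> L \<longrightarrow> \<psi> \<in> L) \<and>
     (\<forall>\<phi>. \<phi> \<in> L \<longrightarrow> Box \<phi> \<in> L) \<and>
     (\<forall>\<sigma> \<phi>. \<phi> \<in> L \<longrightarrow> subst \<sigma> \<phi> \<in> L)"

definition GL :: "form set" where
  "GL = \<Inter>{L. normal_logic L \<and> axiom_Loeb \<in> L}"

lemma normal_logic_GL: "normal_logic GL"
  unfolding GL_def normal_logic_def by blast

lemma axiom_Loeb_in_GL: "axiom_Loeb \<in> GL"
  unfolding GL_def by blast

lemma GL_least: "normal_logic L \<Longrightarrow> axiom_Loeb \<in> L \<Longrightarrow> GL \<subseteq> L"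
  unfolding GL_def by blast

definition uniform_Lyndon_interpolant ::
  "form set \<Rightarrow> form \<Rightarrow> nat set \<Rightarrow> nat set \<Rightarrow> form \<Rightarrow> bool" where
  "uniform_Lyndon_interpolant L \<phi> P Q \<theta> \<longleftrightarrow>
     vpos \<theta> \<subseteq> vpos \<phi> - P \<and>
     vneg \<theta> \<subseteq> vneg \<phi> - Q \<and>
     (\<phi> \<rightarrow>\<^sub>f \<theta>) \<in> L \<and>
     (\<forall>\<psi>. vpos \<psi> \<inter> P = {} \<and> vneg \<psi> \<inter> Q = {} \<and> (\<phi> \<rightarrow>\<^sub>f \<psi>) \<in> L \<longrightarrow> (\<theta> \<rightarrow>\<^sub>f \<psi>) \<in> L)"

definition ULIP :: "form set \<Rightarrow> bool" where
  "ULIP L \<longleftrightarrow>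
     (\<forall>\<phi> P Q. finite P \<longrightarrow> finite Q \<longrightarrow> (\<exists>\<theta>. uniform_Lyndon_interpolant L \<phi> P Q \<theta>))"

end

theory Submission
  imports Defs
begin

text \<open>
  \<^const>\<open>GL\<close> is sound and complete for transitive, conversely well-founded Kripke models.
  Let \<open>A = v\<^sup>+(\<phi>) - P\<close>, \<open>B = v\<^sup>-(\<phi>) - Q\<close> and \<open>k = 2 n(\<phi>) + 1\<close>. Up to equivalence there are
  finitely many formulas of depth at most \<open>k\<close> with positive variables in \<open>A\<close> and negative
  variables in \<open>B\<close>; the interpolant \<open>\<theta>\<close> is the conjunction of those that follow from \<open>\<phi>\<close>.

  Suppose \<open>\<theta> \<rightarrow> \<psi>\<close> fails at a point \<open>w\<close> of a model \<open>N\<close>. Then some model \<open>M\<close> of \<open>\<phi>\<close> has a root \<open>r\<close>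
  from which there is a directed \<open>k\<close>-round bisimulation to \<open>w\<close>. Amalgamate \<open>M\<close> and \<open>N\<close> into a
  model on pairs \<open>(m, n)\<close> satisfying \<open>\<phi>\<close> at \<open>(r, w)\<close>, whose projection to \<open>N\<close> is a directed
  bisimulation for the variables outside \<open>P\<close> and \<open>Q\<close>. Finitely many rounds suffice: when
  \<open>\<box>\<chi>\<close> fails at \<open>m\<close>, it fails because of a successor where \<open>\<box>\<chi>\<close> holds and \<open>\<chi>\<close> does not, so
  the number of boxed subformulas of \<open>\<phi>\<close> that fail drops; while that number stays the
  same, all moves in \<open>N\<close> are answered from one fixed witness \<open>m\<^sub>0\<close> and cost only one round. Hence
  each drop costs two rounds.
\<close>

section \<open>Kripke semantics\<close>

fun sat :: "('w \<Rightarrow> 'w \<Rightarrow> bool) \<Rightarrow> ('w \<Rightarrow> nat \<Rightarrow> bool) \<Rightarrow> 'w \<Rightarrow> form \<Rightarrow> bool" where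
  "sat R V w (Var p) = V w p"
| "sat R V w Bot = False"
| "sat R V w (Imp \<phi> \<psi>) = (sat R V w \<phi> \<longrightarrow> sat R V w \<psi>)"
| "sat R V w (Box \<phi>) = (\<forall>v. R w v \<longrightarrow> sat R V v \<phi>)"

definition GL_frame :: "('w \<Rightarrow> 'w \<Rightarrow> bool) \<Rightarrow> bool" where
  "GL_frame R \<longleftrightarrow> transp R \<and> wfP (\<lambda>x y. R y x)"

lemma GL_frame_trans: "GL_frame R \<Longrightarrow> R x y \<Longrightarrow> R y z \<Longrightarrow> R x z"
  unfolding GL_frame_def by (meson transpE)

lemma GL_frame_induct:
  assumes "GL_frame R" and "\<And>x. (\<And>y. R x y \<Longrightarrow> P y) \<Longrightarrow> P x"
  shows "P x"
  using assms wfp_induct_rule[of "\<lambda>x y. R y x" P x] unfolding GL_frame_def by blast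

text \<open>Climbing through \<open>P\<close>-successors must stop by converse well-foundedness, and
  transitivity keeps every point reached a successor of \<open>x\<close>. Serves both Loeb's axiom
  and \<open>pair_rel_refuting\<close>.\<close>

lemma GL_frame_maximal:
  assumes R: "GL_frame R" and "R x y" and "P y"
  obtains z where "R x z" "P z" "\<And>u. R z u \<Longrightarrow> \<not> P u"
proof -
  have "R x y \<Longrightarrow> P y \<Longrightarrow> \<exists>z. R x z \<and> P z \<and> (\<forall>u. R z u \<longrightarrow> \<not> P u)" for y
    by (induction y rule: GL_frame_induct[OF R]) (meson GL_frame_trans[OF R])
  then show thesis
    using assms that by blast
qed

lemma sat_Box_Loeb:
  assumes "GL_frame R" and "sat R V w (Box (Box \<phi> \<rightarrow>\<^sub>f \<phi>))"
  shows "sat R V w (Box \<phi>)"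
proof (rule ccontr)
  assume "\<not> ?thesis"
  then obtain v where "R w v" "\<not> sat R V v \<phi>"
    by auto
  then obtain z where "R w z" "\<not> sat R V z \<phi>" "\<And>u. R z u \<Longrightarrow> sat R V u \<phi>"
    using GL_frame_maximal[OF assms(1), where P = "\<lambda>x. \<not> sat R V x \<phi>"] by metis
  then show False
    using assms(2) by auto
qed

lemma sat_eq_bool_eval:
  "sat R V w \<phi> = bool_eval (V w) (\<lambda>\<psi>. sat R V w (Box \<psi>)) \<phi>"
  by (induction \<phi>) auto

lemma sat_tautology: "tautology \<phi> \<Longrightarrow> sat R V w \<phi>"
  by (subst sat_eq_bool_eval) (simp add: tautology_def)

lemma sat_subst: "sat R V w (subst \<sigma> \<phi>) = sat R (\<lambda>v p. sat R V v (\<sigma> p)) w \<phi>"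
  by (induction \<phi> arbitrary: w) auto

theorem GL_sound:
  fixes R :: "'w \<Rightarrow> 'w \<Rightarrow> bool"
  assumes "\<phi> \<in> GL" and "GL_frame R"
  shows "sat R V w \<phi>"
proof -
  \<comment> \<open>Quantifying over \<open>V\<close> inside \<open>?L\<close> gives closure under
    substitution: by \<open>sat_subst\<close> a substitution only changes the valuation.\<close>
  let ?L = "{\<phi>. \<forall>(R :: 'w \<Rightarrow> 'w \<Rightarrow> bool) V w. GL_frame R \<longrightarrow> sat R V w \<phi>}"
  have "normal_logic ?L"
    unfolding normal_logic_def by (auto simp: sat_tautology axiom_K_def sat_subst)
  moreover have "axiom_Loeb \<in> ?L"
    using sat_Box_Loeb by (auto simp: axiom_Loeb_def simp del: sat.simps(4))
  ultimately show ?thesis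
    using GL_least assms by blast
qed

section \<open>Completeness\<close>

text \<open>Necessitation applies to theorems of \<open>GL\<close> only, never to hypotheses;
  otherwise the deduction theorem \<open>derives_ImpI\<close> would fail.\<close>

inductive derives :: "form set \<Rightarrow> form \<Rightarrow> bool" (infix "\<turnstile>" 50) for S where
  logic: "\<phi> \<in> GL \<Longrightarrow> S \<turnstile> \<phi>"
| hyp: "\<phi> \<in> S \<Longrightarrow> S \<turnstile> \<phi>"
| mp: "S \<turnstile> \<phi> \<rightarrow>\<^sub>f \<psi> \<Longrightarrow> S \<turnstile> \<phi> \<Longrightarrow> S \<turnstile> \<psi>"

lemma GL_mp: "\<phi> \<rightarrow>\<^sub>f \<psi> \<in> GL \<Longrightarrow> \<phi> \<in> GL \<Longrightarrow> \<psi> \<in> GL"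
  using normal_logic_GL unfolding normal_logic_def by blast

lemma GL_nec: "\<phi> \<in> GL \<Longrightarrow> Box \<phi> \<in> GL"
  using normal_logic_GL unfolding normal_logic_def by blast

lemma GL_subst: "\<phi> \<in> GL \<Longrightarrow> subst \<sigma> \<phi> \<in> GL"
  using normal_logic_GL unfolding normal_logic_def by blast

lemma GL_taut: "(\<And>g h. bool_eval g h \<phi>) \<Longrightarrow> \<phi> \<in> GL"
  using normal_logic_GL unfolding normal_logic_def tautology_def by blast

lemma GL_K: "Box (\<phi> \<rightarrow>\<^sub>f \<psi>) \<rightarrow>\<^sub>f Box \<phi> \<rightarrow>\<^sub>f Box \<psi> \<in> GL"
proof -
  have "axiom_K \<in> GL"
    using normal_logic_GL unfolding normal_logic_def by blast
  from GL_subst[OF this, of "\<lambda>p. if p = 0 then \<phi> else \<psi>"] show ?thesis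
    by (simp add: axiom_K_def)
qed

lemma GL_Loeb: "Box (Box \<phi> \<rightarrow>\<^sub>f \<phi>) \<rightarrow>\<^sub>f Box \<phi> \<in> GL"
  using GL_subst[OF axiom_Loeb_in_GL, of "\<lambda>p. \<phi>"] by (simp add: axiom_Loeb_def)

lemma derives_empty: "{} \<turnstile> \<phi> \<longleftrightarrow> \<phi> \<in> GL"
proof
  show "{} \<turnstile> \<phi> \<Longrightarrow> \<phi> \<in> GL"
    by (induction rule: derives.induct) (auto intro: GL_mp)
qed (rule derives.logic)

lemma derives_mono: "S \<turnstile> \<phi> \<Longrightarrow> S \<subseteq> T \<Longrightarrow> T \<turnstile> \<phi>"
  by (induction rule: derives.induct) (auto intro: derives.intros)

lemma derives_taut: "(\<And>g h. bool_eval g h \<phi>) \<Longrightarrow> S \<turnstile> \<phi>"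
  by (simp add: GL_taut derives.logic)

lemma derives_cut: "S \<turnstile> \<phi> \<Longrightarrow> (\<And>\<psi>. \<psi> \<in> S \<Longrightarrow> T \<turnstile> \<psi>) \<Longrightarrow> T \<turnstile> \<phi>"
  by (induction rule: derives.induct) (auto intro: derives.intros)

lemma derives_ImpI:
  assumes "insert \<phi> S \<turnstile> \<psi>"
  shows "S \<turnstile> \<phi> \<rightarrow>\<^sub>f \<psi>"
  using assms
proof (induction rule: derives.induct)
  case (logic \<psi>)
  then show ?case
    by (meson bool_eval.simps(3) derives.mp derives.logic derives_taut)
next
  case (hyp \<psi>)
  have "S \<turnstile> \<psi> \<rightarrow>\<^sub>f \<phi> \<rightarrow>\<^sub>f \<psi>" "S \<turnstile> \<phi> \<rightarrow>\<^sub>f \<phi>"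
    by (auto intro: derives_taut)
  with hyp show ?case
    by (auto intro: derives.intros)
next
  case (mp \<chi> \<psi>)
  have "S \<turnstile> (\<phi> \<rightarrow>\<^sub>f \<chi> \<rightarrow>\<^sub>f \<psi>) \<rightarrow>\<^sub>f (\<phi> \<rightarrow>\<^sub>f \<chi>) \<rightarrow>\<^sub>f \<phi> \<rightarrow>\<^sub>f \<psi>"
    by (auto intro: derives_taut)
  with mp.IH show ?case
    by (blast intro: derives.mp)
qed

lemma derives_nec: "S \<turnstile> \<phi> \<Longrightarrow> Box ` S \<turnstile> Box \<phi>"
proof (induction rule: derives.induct)
  case (mp \<phi> \<psi>)
  then show ?case
    by (meson GL_K derives.mp derives.logic)
qed (auto intro: derives.intros GL_nec)

lemma derives_finite: "S \<turnstile> \<phi> \<Longrightarrow> \<exists>T. finite T \<and> T \<subseteq> S \<and> T \<turnstile> \<phi>"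
proof (induction rule: derives.induct)
  case (logic \<phi>)
  then show ?case
    by (meson derives.logic empty_subsetI finite.emptyI)
next
  case (hyp \<phi>)
  then have "finite {\<phi>} \<and> {\<phi>} \<subseteq> S \<and> {\<phi>} \<turnstile> \<phi>"
    by (simp add: derives.hyp)
  then show ?case
    by blast
next
  case (mp \<phi> \<psi>)
  then obtain T U where "finite T" "T \<subseteq> S" "T \<turnstile> \<phi> \<rightarrow>\<^sub>f \<psi>" "finite U" "U \<subseteq> S" "U \<turnstile> \<phi>"
    by blast
  then have "finite (T \<union> U) \<and> T \<union> U \<subseteq> S \<and> T \<union> U \<turnstile> \<psi>"
    by (meson Un_least derives.mp derives_mono finite_UnI sup_ge1 sup_ge2)
  then show ?case
    by blast
qed

text \<open>The Loeb axiom for \<open>\<chi> = \<phi> \<and> \<box>\<phi>\<close> applies because \<open>\<phi>\<close> alone yields \<open>\<box>\<chi> \<rightarrow> \<chi>\<close>.\<close>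

lemma GL_4: "Box \<phi> \<rightarrow>\<^sub>f Box (Box \<phi>) \<in> GL"
proof -
  let ?\<chi> = "(\<phi> \<rightarrow>\<^sub>f Box \<phi> \<rightarrow>\<^sub>f Bot) \<rightarrow>\<^sub>f Bot"
  have fst: "?\<chi> \<rightarrow>\<^sub>f \<phi> \<in> GL" and snd: "?\<chi> \<rightarrow>\<^sub>f Box \<phi> \<in> GL"
    by (auto intro: GL_taut)
  have Bfst: "Box ?\<chi> \<rightarrow>\<^sub>f Box \<phi> \<in> GL" and Bsnd: "Box ?\<chi> \<rightarrow>\<^sub>f Box (Box \<phi>) \<in> GL"
    using GL_mp[OF GL_K GL_nec[OF fst]] GL_mp[OF GL_K GL_nec[OF snd]] .
  have "(Box ?\<chi> \<rightarrow>\<^sub>f Box \<phi>) \<rightarrow>\<^sub>f \<phi> \<rightarrow>\<^sub>f Box ?\<chi> \<rightarrow>\<^sub>f ?\<chi> \<in> GL"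
    by (auto intro: GL_taut)
  from GL_mp[OF this Bfst] have "\<phi> \<rightarrow>\<^sub>f Box ?\<chi> \<rightarrow>\<^sub>f ?\<chi> \<in> GL" .
  from GL_mp[OF GL_K GL_nec[OF this]] have "Box \<phi> \<rightarrow>\<^sub>f Box (Box ?\<chi> \<rightarrow>\<^sub>f ?\<chi>) \<in> GL" .
  then have "{Box \<phi>} \<turnstile> Box (Box ?\<chi> \<rightarrow>\<^sub>f ?\<chi>)"
    by (meson derives.hyp derives.mp derives.logic singletonI)
  then have "{Box \<phi>} \<turnstile> Box (Box \<phi>)"
    by (meson Bsnd GL_Loeb derives.mp derives.logic)
  then show ?thesis
    using derives_ImpI derives_empty by blast
qed

section \<open>Maximal consistent sets\<close>

definition consistent :: "form set \<Rightarrow> bool" where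
  "consistent S \<longleftrightarrow> \<not> S \<turnstile> Bot"

definition mcs :: "form set \<Rightarrow> bool" where
  "mcs S \<longleftrightarrow> consistent S \<and> (\<forall>T. consistent T \<longrightarrow> S \<subseteq> T \<longrightarrow> T = S)"

lemma Lindenbaum:
  assumes "consistent S"
  obtains T where "S \<subseteq> T" "mcs T"
proof -
  let ?A = "{T. S \<subseteq> T \<and> consistent T}"
  have "\<exists>M\<in>?A. \<forall>X\<in>?A. M \<subseteq> X \<longrightarrow> X = M"
  proof (rule subset_Zorn_nonempty)
    show "?A \<noteq> {}"
      using assms by blast
  next
    fix C assume C: "C \<noteq> {}" "subset.chain ?A C"
    \<comment> \<open>A derivation of \<open>Bot\<close> uses finitely many hypotheses, and these
      already lie in one member of the chain.\<close>
    have "consistent (\<Union>C)"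
      unfolding consistent_def
    proof
      assume "\<Union>C \<turnstile> Bot"
      then obtain T where T: "finite T" "T \<subseteq> \<Union>C" "T \<turnstile> Bot"
        using derives_finite by blast
      then obtain X where "X \<in> C" "T \<subseteq> X"
        using finite_subset_Union_chain C by metis
      then have "consistent X" "X \<turnstile> Bot"
        using T(3) C(2) derives_mono unfolding subset.chain_def by auto
      then show False
        unfolding consistent_def by blast
    qed
    with C show "\<Union>C \<in> ?A"
      unfolding subset.chain_def by blast
  qed
  then obtain T where T: "T \<in> ?A" "\<forall>X\<in>?A. T \<subseteq> X \<longrightarrow> X = T"
    by (rule bexE)
  have "mcs T"
    unfolding mcs_def
  proof (intro conjI allI impI)
    fix X assume "consistent X" "T \<subseteq> X"
    with T show "X = T"
      by (metis (mono_tags, lifting) mem_Collect_eq order_trans)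
  qed (use T(1) in simp)
  with T(1) show thesis
    using that by blast
qed

lemma mcs_closed:
  assumes "mcs S" and "S \<turnstile> \<phi>"
  shows "\<phi> \<in> S"
proof -
  have "consistent (insert \<phi> S)"
    unfolding consistent_def
  proof
    assume "insert \<phi> S \<turnstile> Bot"
    then have "S \<turnstile> Bot"
      by (rule derives_cut) (auto intro: derives.hyp assms(2))
    with assms(1) show False
      unfolding mcs_def consistent_def by blast
  qed
  with assms(1) show ?thesis
    unfolding mcs_def by blast
qed

lemma mcs_mp: "mcs S \<Longrightarrow> \<phi> \<rightarrow>\<^sub>f \<psi> \<in> S \<Longrightarrow> \<phi> \<in> S \<Longrightarrow> \<psi> \<in> S"
  by (meson derives.hyp derives.mp mcs_closed)

lemma mcs_Bot: "mcs S \<Longrightarrow> Bot \<notin> S"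
  unfolding mcs_def consistent_def using derives.hyp by blast

lemma mcs_neg:
  assumes "mcs S" and "\<phi> \<notin> S"
  shows "\<phi> \<rightarrow>\<^sub>f Bot \<in> S"
proof -
  have "\<not> consistent (insert \<phi> S)"
    using assms unfolding mcs_def by blast
  then show ?thesis
    unfolding consistent_def using derives_ImpI mcs_closed assms(1) by blast
qed

lemma mcs_Imp:
  assumes "mcs S"
  shows "\<phi> \<rightarrow>\<^sub>f \<psi> \<in> S \<longleftrightarrow> (\<phi> \<in> S \<longrightarrow> \<psi> \<in> S)"
proof
  assume "\<phi> \<in> S \<longrightarrow> \<psi> \<in> S"
  moreover have "(\<phi> \<rightarrow>\<^sub>f Bot) \<rightarrow>\<^sub>f \<phi> \<rightarrow>\<^sub>f \<psi> \<in> S" "\<psi> \<rightarrow>\<^sub>f \<phi> \<rightarrow>\<^sub>f \<psi> \<in> S"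
    by (auto intro!: mcs_closed[OF assms] derives_taut)
  ultimately show "\<phi> \<rightarrow>\<^sub>f \<psi> \<in> S"
    using assms mcs_mp mcs_neg by blast
qed (use assms mcs_mp in blast)

text \<open>If the required set were inconsistent, the boxed members of \<open>?B\<close> would
  yield \<open>Box (Box \<psi> \<rightarrow>\<^sub>f \<psi>)\<close>, hence
  \<open>Box \<psi>\<close> by Loeb; they lie in \<open>S\<close>, by assumption or by
  \<open>GL_4\<close>. Loeb is what allows \<open>Box \<psi>\<close> to be put into
  \<open>T\<close>.\<close>

lemma mcs_Box_witness:
  assumes S: "mcs S" and "Box \<psi> \<notin> S"
  obtains T where "mcs T" "\<And>\<chi>. Box \<chi> \<in> S \<Longrightarrow> \<chi> \<in> T \<and> Box \<chi> \<in> T" "Box \<psi> \<in> T" "\<psi> \<notin> T"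
proof -
  let ?B = "{\<chi>. Box \<chi> \<in> S} \<union> {Box \<chi> |\<chi>. Box \<chi> \<in> S}"
  have "consistent (insert (\<psi> \<rightarrow>\<^sub>f Bot) (insert (Box \<psi>) ?B))"
    unfolding consistent_def
  proof
    assume "insert (\<psi> \<rightarrow>\<^sub>f Bot) (insert (Box \<psi>) ?B) \<turnstile> Bot"
    then have "insert (Box \<psi>) ?B \<turnstile> (\<psi> \<rightarrow>\<^sub>f Bot) \<rightarrow>\<^sub>f Bot"
      by (rule derives_ImpI)
    moreover have "insert (Box \<psi>) ?B \<turnstile> ((\<psi> \<rightarrow>\<^sub>f Bot) \<rightarrow>\<^sub>f Bot) \<rightarrow>\<^sub>f \<psi>"
      by (auto intro: derives_taut)
    ultimately have "?B \<turnstile> Box \<psi> \<rightarrow>\<^sub>f \<psi>"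
      by (meson derives.mp derives_ImpI)
    then have "Box ` ?B \<turnstile> Box (Box \<psi> \<rightarrow>\<^sub>f \<psi>)"
      by (rule derives_nec)
    then have "Box ` ?B \<turnstile> Box \<psi>"
      by (meson GL_Loeb derives.mp derives.logic)
    moreover have "Box (Box \<chi>) \<in> S" if "Box \<chi> \<in> S" for \<chi>
      using mcs_mp[OF S mcs_closed[OF S derives.logic[OF GL_4]] that] .
    then have "Box ` ?B \<subseteq> S"
      by blast
    ultimately have "S \<turnstile> Box \<psi>"
      by (rule derives_mono)
    then show False
      using assms mcs_closed by blast
  qed
  then obtain T where T: "insert (\<psi> \<rightarrow>\<^sub>f Bot) (insert (Box \<psi>) ?B) \<subseteq> T" "mcs T"
    by (rule Lindenbaum)
  then have neg: "\<psi> \<rightarrow>\<^sub>f Bot \<in> T" and box: "Box \<psi> \<in> T" and sub: "?B \<subseteq> T"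
    by simp_all
  have "\<psi> \<notin> T"
    using mcs_mp[OF T(2) neg] mcs_Bot[OF T(2)] by blast
  moreover have "\<chi> \<in> T \<and> Box \<chi> \<in> T" if "Box \<chi> \<in> S" for \<chi>
    using sub that by blast
  ultimately show thesis
    using that[OF T(2) _ box] by blast
qed

text \<open>Requiring a new boxed subformula makes the canonical relation conversely well-founded
  without passing to a finite quotient.\<close>

definition canonical_rel :: "form \<Rightarrow> form set \<Rightarrow> form set \<Rightarrow> bool" where
  "canonical_rel \<phi> S T \<longleftrightarrow> mcs T \<and>
     (\<forall>\<psi>. Box \<psi> \<in> Sub \<phi> \<longrightarrow> Box \<psi> \<in> S \<longrightarrow> \<psi> \<in> T \<and> Box \<psi> \<in> T) \<and>
     (\<exists>\<psi>. Box \<psi> \<in> Sub \<phi> \<and> Box \<psi> \<in> T \<and> Box \<psi> \<notin> S)"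

lemma GL_frame_canonical_rel: "GL_frame (canonical_rel \<phi>)"
proof -
  \<comment> \<open>Along the relation the boxed subformulas of \<open>\<phi>\<close> are kept and
    one is gained, so this count drops.\<close>
  let ?f = "\<lambda>S. card (Sub \<phi> - {Box \<psi> |\<psi>. Box \<psi> \<in> S})"
  have "?f T < ?f S" if "canonical_rel \<phi> S T" for S T
    using that unfolding canonical_rel_def
    by (intro psubset_card_mono) (auto simp: finite_Sub)
  then have "wfP (\<lambda>T S. canonical_rel \<phi> S T)"
    by (intro wfp_if_convertible_to_nat[where f = ?f])
  moreover have "transp (canonical_rel \<phi>)"
    unfolding canonical_rel_def by (intro transpI) blast
  ultimately show ?thesis
    unfolding GL_frame_def by blast
qed

lemma Sub_refl: "\<phi> \<in> Sub \<phi>"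
  by (cases \<phi>) auto

lemma Sub_trans: "\<psi> \<in> Sub \<phi> \<Longrightarrow> Sub \<psi> \<subseteq> Sub \<phi>"
  by (induction \<phi>) auto

lemma Sub_ImpD: "\<psi> \<rightarrow>\<^sub>f \<chi> \<in> Sub \<phi> \<Longrightarrow> \<psi> \<in> Sub \<phi> \<and> \<chi> \<in> Sub \<phi>"
  using Sub_trans[of "\<psi> \<rightarrow>\<^sub>f \<chi>" \<phi>] Sub_refl by auto

lemma Sub_BoxD: "Box \<psi> \<in> Sub \<phi> \<Longrightarrow> \<psi> \<in> Sub \<phi>"
  using Sub_trans[of "Box \<psi>" \<phi>] Sub_refl by auto

lemma canonical_truth:
  "\<psi> \<in> Sub \<phi> \<Longrightarrow> mcs S \<Longrightarrow> sat (canonical_rel \<phi>) (\<lambda>S p. Var p \<in> S) S \<psi> \<longleftrightarrow> \<psi> \<in> S"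
proof (induction \<psi> arbitrary: S)
  case (Imp \<psi> \<chi>)
  then show ?case
    using Sub_ImpD[OF Imp.prems(1)] by (simp add: mcs_Imp)
next
  case (Box \<psi>)
  have IH: "sat (canonical_rel \<phi>) (\<lambda>S p. Var p \<in> S) T \<psi> \<longleftrightarrow> \<psi> \<in> T" if "mcs T" for T
    using Box.IH[OF Sub_BoxD[OF Box.prems(1)] that] .
  show ?case
  proof
    assume sat: "sat (canonical_rel \<phi>) (\<lambda>S p. Var p \<in> S) S (Box \<psi>)"
    show "Box \<psi> \<in> S"
    proof (rule ccontr)
      assume "Box \<psi> \<notin> S"
      then obtain T where T: "mcs T" "\<And>\<chi>. Box \<chi> \<in> S \<Longrightarrow> \<chi> \<in> T \<and> Box \<chi> \<in> T"
          "Box \<psi> \<in> T" "\<psi> \<notin> T"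
        using mcs_Box_witness[OF Box.prems(2)] by metis
      \<comment> \<open>\<open>Box \<psi>\<close> itself is the new boxed subformula that the
        relation demands.\<close>
      then have "canonical_rel \<phi> S T"
        using Box.prems(1) \<open>Box \<psi> \<notin> S\<close> unfolding canonical_rel_def by blast
      with sat T IH show False
        by auto
    qed
  next
    assume "Box \<psi> \<in> S"
    then show "sat (canonical_rel \<phi>) (\<lambda>S p. Var p \<in> S) S (Box \<psi>)"
      using IH Box.prems(1) unfolding canonical_rel_def by auto
  qed
qed (use mcs_Bot in auto)

theorem GL_complete:
  assumes "\<phi> \<notin> GL"
  obtains R :: "form set \<Rightarrow> form set \<Rightarrow> bool" and V w where "GL_frame R" "\<not> sat R V w \<phi>"
proof -
  have "consistent {\<phi> \<rightarrow>\<^sub>f Bot}"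
    unfolding consistent_def
  proof
    assume "{\<phi> \<rightarrow>\<^sub>f Bot} \<turnstile> Bot"
    then have "(\<phi> \<rightarrow>\<^sub>f Bot) \<rightarrow>\<^sub>f Bot \<in> GL"
      using derives_ImpI derives_empty by blast
    moreover have "((\<phi> \<rightarrow>\<^sub>f Bot) \<rightarrow>\<^sub>f Bot) \<rightarrow>\<^sub>f \<phi> \<in> GL"
      by (auto intro: GL_taut)
    ultimately show False
      using assms GL_mp by blast
  qed
  then obtain S where "\<phi> \<rightarrow>\<^sub>f Bot \<in> S" "mcs S"
    using Lindenbaum by (metis insert_subset)
  then have "\<phi> \<notin> S" "mcs S"
    using mcs_mp mcs_Bot by blast+
  then show thesis
    using that GL_frame_canonical_rel canonical_truth Sub_refl by metis
qed

section \<open>Directed bisimulations\<close>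

definition Neg :: "form \<Rightarrow> form" where
  "Neg \<phi> = \<phi> \<rightarrow>\<^sub>f Bot"

definition Disj :: "form list \<Rightarrow> form" where
  "Disj xs = foldr (\<lambda>\<phi> \<psi>. Neg \<phi> \<rightarrow>\<^sub>f \<psi>) xs Bot"

text \<open>The fold is a chain of implications ending in \<open>Bot\<close>, saying that not all
  entries hold. As with \<open>Disj\<close>, entries keep their polarity and depth.\<close>

definition Conj :: "form list \<Rightarrow> form" where
  "Conj xs = Neg (foldr (\<lambda>\<phi> \<psi>. \<phi> \<rightarrow>\<^sub>f \<psi>) xs Bot)"

definition Dia :: "form \<Rightarrow> form" where
  "Dia \<phi> = Neg (Box (Neg \<phi>))"

lemma Neg_simps [simp]:
  "sat R V w (Neg \<phi>) \<longleftrightarrow> \<not> sat R V w \<phi>" "vpos (Neg \<phi>) = vneg \<phi>" "vneg (Neg \<phi>) = vpos \<phi>"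
  "depth (Neg \<phi>) = depth \<phi>"
  by (auto simp: Neg_def)

lemma Dia_simps [simp]:
  "sat R V w (Dia \<phi>) \<longleftrightarrow> (\<exists>v. R w v \<and> sat R V v \<phi>)" "vpos (Dia \<phi>) = vpos \<phi>"
  "vneg (Dia \<phi>) = vneg \<phi>" "depth (Dia \<phi>) = depth \<phi> + 1"
  by (auto simp: Dia_def)

lemma Disj_simps [simp]:
  "sat R V w (Disj xs) \<longleftrightarrow> (\<exists>\<phi>\<in>set xs. sat R V w \<phi>)"
  "vpos (Disj xs) = (\<Union>\<phi>\<in>set xs. vpos \<phi>)" "vneg (Disj xs) = (\<Union>\<phi>\<in>set xs. vneg \<phi>)"
  "depth (Disj xs) \<le> k \<longleftrightarrow> (\<forall>\<phi>\<in>set xs. depth \<phi> \<le> k)"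
  by (induction xs) (auto simp: Disj_def)

lemma Conj_simps [simp]:
  "sat R V w (Conj xs) \<longleftrightarrow> (\<forall>\<phi>\<in>set xs. sat R V w \<phi>)"
  "vpos (Conj xs) = (\<Union>\<phi>\<in>set xs. vpos \<phi>)" "vneg (Conj xs) = (\<Union>\<phi>\<in>set xs. vneg \<phi>)"
  "depth (Conj xs) \<le> k \<longleftrightarrow> (\<forall>\<phi>\<in>set xs. depth \<phi> \<le> k)"
  by (induction xs) (auto simp: Conj_def)

text \<open>The formulas needed for a \<open>k\<close>-round back-and-forth argument; they stand in for all formulas
  of depth at most \<open>k\<close> over the literals \<open>ls\<close>.\<close>

fun layer :: "form list \<Rightarrow> nat \<Rightarrow> form list" where
  "layer ls 0 = ls"
| "layer ls (Suc k) = ls @ map (\<lambda>xs. Box (Disj xs)) (subseqs (layer ls k))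
     @ map (\<lambda>xs. Dia (Conj xs)) (subseqs (layer ls k))"

lemma subseqs_mem: "xs \<in> set (subseqs ys) \<Longrightarrow> x \<in> set xs \<Longrightarrow> x \<in> set ys"
  using subseqs_powset[of ys] by blast

lemma subseqs_filterE:
  obtains ys where "ys \<in> set (subseqs xs)" "set ys = {x \<in> set xs. P x}"
proof -
  have "{x \<in> set xs. P x} \<in> set ` set (subseqs xs)"
    by (auto simp: subseqs_powset)
  then show thesis
    using that by blast
qed

lemma layer_vars_depth:
  assumes "\<And>\<chi>. \<chi> \<in> set ls \<Longrightarrow> vpos \<chi> \<subseteq> A \<and> vneg \<chi> \<subseteq> B \<and> depth \<chi> = 0"
  shows "\<chi> \<in> set (layer ls k) \<Longrightarrow> vpos \<chi> \<subseteq> A \<and> vneg \<chi> \<subseteq> B \<and> depth \<chi> \<le> k"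
proof (induction k arbitrary: \<chi>)
  case (Suc k)
  have "vpos \<chi>' \<subseteq> A \<and> vneg \<chi>' \<subseteq> B \<and> depth \<chi>' \<le> k"
    if "xs \<in> set (subseqs (layer ls k))" "\<chi>' \<in> set xs" for xs \<chi>'
    using Suc.IH subseqs_mem[OF that] .
  then have "vpos \<chi>' \<subseteq> A" "vneg \<chi>' \<subseteq> B" "depth \<chi>' \<le> k"
    if "xs \<in> set (subseqs (layer ls k))" "\<chi>' \<in> {Disj xs, Conj xs}" for xs \<chi>'
    using that by (fastforce+)
  with Suc.prems assms show ?case
    by fastforce
qed (use assms in auto)

section \<open>Back and forth between two models\<close>

locale two_models =
  fixes R1 :: "'m \<Rightarrow> 'm \<Rightarrow> bool" and V1 :: "'m \<Rightarrow> nat \<Rightarrow> bool"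
    and R2 :: "'n \<Rightarrow> 'n \<Rightarrow> bool" and V2 :: "'n \<Rightarrow> nat \<Rightarrow> bool"
begin

definition layer_le :: "form list \<Rightarrow> nat \<Rightarrow> 'm \<Rightarrow> 'n \<Rightarrow> bool" where
  "layer_le ls k m n \<longleftrightarrow> (\<forall>\<chi>\<in>set (layer ls k). sat R1 V1 m \<chi> \<longrightarrow> sat R2 V2 n \<chi>)"

lemma layer_le_literals:
  "layer_le ls k m n \<Longrightarrow> \<chi> \<in> set ls \<Longrightarrow> sat R1 V1 m \<chi> \<Longrightarrow> sat R2 V2 n \<chi>"
  unfolding layer_le_def by (cases k) auto

text \<open>The layer-\<open>k\<close> formulas true at \<open>m'\<close> are finitely many, so a
  single diamond over their conjunction, itself in the next layer, describes
  \<open>m'\<close>.\<close>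

lemma layer_le_forth:
  assumes "layer_le ls (Suc k) m n" and "R1 m m'"
  obtains n' where "R2 n n'" "layer_le ls k m' n'"
proof -
  obtain xs where xs: "xs \<in> set (subseqs (layer ls k))"
      "set xs = {\<chi> \<in> set (layer ls k). sat R1 V1 m' \<chi>}"
    by (rule subseqs_filterE)
  have "sat R1 V1 m (Dia (Conj xs))"
    using xs assms(2) by auto
  moreover have "Dia (Conj xs) \<in> set (layer ls (Suc k))"
    using xs by simp
  ultimately have "sat R2 V2 n (Dia (Conj xs))"
    using assms(1) unfolding layer_le_def by blast
  then show thesis
    using that xs unfolding layer_le_def by auto
qed

text \<open>Dually, a box over the disjunction of the layer-\<open>k\<close> formulas false at
  \<open>n'\<close> fails at \<open>n\<close>, hence at \<open>m\<close>.\<close>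

lemma layer_le_back:
  assumes "layer_le ls (Suc k) m n" and "R2 n n'"
  obtains m' where "R1 m m'" "layer_le ls k m' n'"
proof -
  obtain xs where xs: "xs \<in> set (subseqs (layer ls k))"
      "set xs = {\<chi> \<in> set (layer ls k). \<not> sat R2 V2 n' \<chi>}"
    by (rule subseqs_filterE)
  have "\<not> sat R2 V2 n (Box (Disj xs))"
    using xs assms(2) by auto
  moreover have "Box (Disj xs) \<in> set (layer ls (Suc k))"
    using xs by simp
  ultimately have "\<not> sat R1 V1 m (Box (Disj xs))"
    using assms(1) unfolding layer_le_def by blast
  then show thesis
    using that xs unfolding layer_le_def by auto
qed

text \<open>Instead of comparing the lists, the proof plays the game: a box or diamond of the lower
  layer is tested at successors, where the induction hypothesis applies.\<close>

lemma layer_le_Suc: "layer_le ls (Suc k) m n \<Longrightarrow> layer_le ls k m n"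
proof (induction k arbitrary: m n)
  case 0
  then show ?case
    unfolding layer_le_def by simp
next
  case (Suc k)
  have "sat R2 V2 n \<chi>" if mem: "\<chi> \<in> set (layer ls (Suc k))" and sat: "sat R1 V1 m \<chi>" for \<chi>
  proof -
    consider "\<chi> \<in> set ls"
      | xs where "xs \<in> set (subseqs (layer ls k))" "\<chi> = Box (Disj xs)"
      | xs where "xs \<in> set (subseqs (layer ls k))" "\<chi> = Dia (Conj xs)"
      using mem by auto
    then show ?thesis
    proof cases
      case 1
      then show ?thesis
        using layer_le_literals Suc.prems sat by blast
    next
      case (2 xs)
      have "sat R2 V2 n' (Disj xs)" if n': "R2 n n'" for n'
      proof -
        obtain m' where m': "R1 m m'" "layer_le ls (Suc k) m' n'"
          using layer_le_back[OF Suc.prems n'] by blast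
        then have "layer_le ls k m' n'"
          using Suc.IH by blast
        then show ?thesis
          using sat m'(1) 2 subseqs_mem[OF 2(1)] unfolding layer_le_def by fastforce
      qed
      then show ?thesis
        using 2 by simp
    next
      case (3 xs)
      then obtain m' where m': "R1 m m'" "sat R1 V1 m' (Conj xs)"
        using sat by auto
      obtain n' where n': "R2 n n'" "layer_le ls (Suc k) m' n'"
        using layer_le_forth[OF Suc.prems m'(1)] by blast
      then have "layer_le ls k m' n'"
        using Suc.IH by blast
      then have "sat R2 V2 n' (Conj xs)"
        using m'(2) subseqs_mem[OF 3(1)] unfolding layer_le_def by simp
      then show ?thesis
        using 3 n'(1) by auto
    qed
  qed
  then show ?case
    unfolding layer_le_def by blast
qed

lemma layer_le_antimono: "layer_le ls k m n \<Longrightarrow> j \<le> k \<Longrightarrow> layer_le ls j m n"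
  by (induction k) (auto simp: le_Suc_eq intro: layer_le_Suc)

text \<open>Implication exchanges positive and negative variables, so preservation from the first
  model to the second and, with \<open>P\<close> and \<open>Q\<close> exchanged, back again must be
  proved together.\<close>

lemma directed_bisimulation:
  assumes forward: "\<And>m n m'. Z m n \<Longrightarrow> R1 m m' \<Longrightarrow> \<exists>n'. R2 n n' \<and> Z m' n'"
    and backward: "\<And>m n n'. Z m n \<Longrightarrow> R2 n n' \<Longrightarrow> \<exists>m'. R1 m m' \<and> Z m' n'"
    and up: "\<And>m n p. Z m n \<Longrightarrow> p \<notin> P \<Longrightarrow> V1 m p \<Longrightarrow> V2 n p"
    and down: "\<And>m n p. Z m n \<Longrightarrow> p \<notin> Q \<Longrightarrow> V2 n p \<Longrightarrow> V1 m p"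
    and "Z m n"
  shows "(vpos \<psi> \<inter> P = {} \<longrightarrow> vneg \<psi> \<inter> Q = {} \<longrightarrow> sat R1 V1 m \<psi> \<longrightarrow> sat R2 V2 n \<psi>) \<and>
    (vpos \<psi> \<inter> Q = {} \<longrightarrow> vneg \<psi> \<inter> P = {} \<longrightarrow> sat R2 V2 n \<psi> \<longrightarrow> sat R1 V1 m \<psi>)"
  using \<open>Z m n\<close>
proof (induction \<psi> arbitrary: m n)
  case (Var p)
  then show ?case
    using up down by auto
next
  case (Imp \<psi> \<chi>)
  show ?case
    using Imp.IH[OF Imp.prems] by (auto simp: Int_Un_distrib2)
next
  case (Box \<psi>)
  then show ?case
    using forward backward by simp meson
qed simp

end

section \<open>Amalgamation\<close>

locale amalgam = two_models R1 V1 R2 V2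
  for R1 :: "'m \<Rightarrow> 'm \<Rightarrow> bool" and V1 :: "'m \<Rightarrow> nat \<Rightarrow> bool"
    and R2 :: "'n \<Rightarrow> 'n \<Rightarrow> bool" and V2 :: "'n \<Rightarrow> nat \<Rightarrow> bool" +
  fixes \<phi> :: form and P Q :: "nat set" and ls :: "form list"
  assumes frame1: "GL_frame R1" and frame2: "GL_frame R2"
    and pos_literal: "p \<in> vpos \<phi> \<Longrightarrow> p \<notin> P \<Longrightarrow> Var p \<in> set ls"
    and neg_literal: "p \<in> vneg \<phi> \<Longrightarrow> p \<notin> Q \<Longrightarrow> Neg (Var p) \<in> set ls"
begin

definition failing :: "'m \<Rightarrow> form set" where
  "failing m = {\<psi>. Box \<psi> \<in> Sub \<phi> \<and> \<not> sat R1 V1 m (Box \<psi>)}"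

abbreviation rank :: "'m \<Rightarrow> nat" where
  "rank m \<equiv> card (failing m)"

text \<open>A pair has a budget of \<open>2 * rank m\<close> rounds. Its witness \<open>m0\<close>,
  \<open>n0\<close> has one round more and is kept while \<open>failing\<close> is constant: a move
  from \<open>n\<close> is by transitivity a move from \<open>n0\<close>, so answering it from
  \<open>m0\<close> costs one round, however many moves came before.\<close>

definition pairs :: "('m \<times> 'n) set" where
  "pairs = {(m, n). layer_le ls (2 * rank m) m n \<and>
     (\<exists>m0 n0. failing m0 = failing m \<and> layer_le ls (2 * rank m + 1) m0 n0 \<and> (n0 = n \<or> R2 n0 n))}"

text \<open>No \<open>R1\<close>-step is demanded between first components, since answers start from
  the witness \<open>m0\<close>, not from \<open>m\<close>; only the boxed subformulas of
  \<open>\<phi>\<close> must keep their force.\<close>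

definition pair_rel :: "'m \<times> 'n \<Rightarrow> 'm \<times> 'n \<Rightarrow> bool" where
  "pair_rel x y \<longleftrightarrow> y \<in> pairs \<and> R2 (snd x) (snd y) \<and>
     (\<forall>\<psi>. Box \<psi> \<in> Sub \<phi> \<longrightarrow> sat R1 V1 (fst x) (Box \<psi>) \<longrightarrow>
        sat R1 V1 (fst y) \<psi> \<and> sat R1 V1 (fst y) (Box \<psi>))"

text \<open>On \<open>pairs\<close>, the least valuation above \<open>V2\<close> outside
  \<open>Q\<close> and above \<open>V1\<close> on \<open>vpos \<phi>\<close>. The matching upper
  bounds, \<open>V2\<close> outside \<open>P\<close> and \<open>V1\<close> on
  \<open>vneg \<phi>\<close>, come from the literals in \<open>ls\<close>.\<close>

definition pair_val :: "'m \<times> 'n \<Rightarrow> nat \<Rightarrow> bool" where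
  "pair_val x p \<longleftrightarrow> p \<notin> Q \<and> V2 (snd x) p \<or> p \<in> vpos \<phi> \<and> V1 (fst x) p"

lemma finite_failing: "finite (failing m)"
  by (rule finite_subset[OF _ finite_boxed_Sub[of \<phi>]]) (auto simp: failing_def)

lemma rank_le_nbox: "rank m \<le> nbox \<phi>"
  unfolding nbox_def by (rule card_mono[OF finite_boxed_Sub]) (auto simp: failing_def)

lemma failing_antimono: "R1 m m' \<Longrightarrow> failing m' \<subseteq> failing m"
  unfolding failing_def using GL_frame_trans[OF frame1] by auto

lemma rank_less: "failing m' \<subset> failing m \<Longrightarrow> rank m' < rank m"
  by (rule psubset_card_mono[OF finite_failing])

text \<open>The pair serves as its own witness.\<close>

lemma layer_le_imp_pairs: "layer_le ls (2 * rank m + 1) m n \<Longrightarrow> (m, n) \<in> pairs"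
  unfolding pairs_def using layer_le_Suc by auto

lemma GL_frame_pair_rel: "GL_frame pair_rel"
proof -
  have "wfP (\<lambda>n' n. R2 n n')"
    using frame2 unfolding GL_frame_def by blast
  then have "wfP (\<lambda>x y. pair_rel y x)"
    by (rule wfp_if_convertible_to_wfp[where f = snd]) (simp add: pair_rel_def)
  moreover have "transp pair_rel"
    unfolding pair_rel_def by (intro transpI) (meson GL_frame_trans[OF frame2])
  ultimately show ?thesis
    unfolding GL_frame_def by blast
qed

lemma pair_rel_back:
  assumes "(m, n) \<in> pairs" and "R2 n n'"
  obtains m' where "pair_rel (m, n) (m', n')"
proof -
  obtain m0 n0 where m0: "failing m0 = failing m" "layer_le ls (2 * rank m + 1) m0 n0"
      "n0 = n \<or> R2 n0 n"
    using assms(1) unfolding pairs_def by auto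
  then have "R2 n0 n'"
    using assms(2) GL_frame_trans[OF frame2] by blast
  \<comment> \<open>The answer starts at the witness \<open>m0\<close>, whose extra round pays for
    this move.\<close>
  with m0(2) obtain m' where m': "R1 m0 m'" "layer_le ls (2 * rank m) m' n'"
    using layer_le_back[of ls "2 * rank m" m0 n0 n'] by auto
  \<comment> \<open>With \<open>failing\<close> unchanged the old witness serves the new pair;
    otherwise \<open>2 * rank m' + 1 < 2 * rank m\<close>, and the new pair can be its own
    witness.\<close>
  have "(m', n') \<in> pairs"
  proof (cases "failing m' = failing m0")
    case True
    then show ?thesis
      unfolding pairs_def using m0 m' \<open>R2 n0 n'\<close> by auto
  next
    case False
    then have "rank m' < rank m"
      using rank_less[of m' m0] failing_antimono[OF m'(1)] m0(1) by auto
    then show ?thesis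
      by (intro layer_le_imp_pairs layer_le_antimono[OF m'(2)]) simp
  qed
  moreover have "sat R1 V1 m' \<psi> \<and> sat R1 V1 m' (Box \<psi>)"
    if "Box \<psi> \<in> Sub \<phi>" "sat R1 V1 m (Box \<psi>)" for \<psi>
  proof -
    have "sat R1 V1 m0 (Box \<psi>)"
      using that m0(1) unfolding failing_def by blast
    then show ?thesis
      using m'(1) GL_frame_trans[OF frame1] by auto
  qed
  ultimately show thesis
    using that assms(2) unfolding pair_rel_def by auto
qed

text \<open>At a last refuting successor of \<open>m\<close>, \<open>Box \<psi>\<close> holds, so
  the rank drops and the budget shrinks by at least two. One round pays for the step, the other
  gives the new pair the extra round of its own witness.\<close>

lemma pair_rel_refuting:
  assumes "(m, n) \<in> pairs" and "Box \<psi> \<in> Sub \<phi>" and "\<not> sat R1 V1 m (Box \<psi>)"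
  obtains m' n' where "pair_rel (m, n) (m', n')" "\<not> sat R1 V1 m' \<psi>"
proof -
  obtain v where "R1 m v" "\<not> sat R1 V1 v \<psi>"
    using assms(3) by auto
  then obtain m' where m': "R1 m m'" "\<not> sat R1 V1 m' \<psi>" "\<And>u. R1 m' u \<Longrightarrow> sat R1 V1 u \<psi>"
    using GL_frame_maximal[OF frame1, where P = "\<lambda>x. \<not> sat R1 V1 x \<psi>"] by metis
  have "\<psi> \<in> failing m" "\<psi> \<notin> failing m'"
    using assms m'(3) unfolding failing_def by auto
  then have rank: "rank m' < rank m"
    using failing_antimono[OF m'(1)] by (intro rank_less) auto
  moreover have "layer_le ls (2 * rank m) m n"
    using assms(1) unfolding pairs_def by auto
  ultimately have "layer_le ls (Suc (2 * rank m' + 1)) m n"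
    by (elim layer_le_antimono) simp
  then obtain n' where n': "R2 n n'" "layer_le ls (2 * rank m' + 1) m' n'"
    using layer_le_forth m'(1) by blast
  have "pair_rel (m, n) (m', n')"
    unfolding pair_rel_def
    using layer_le_imp_pairs[OF n'(2)] n'(1) m'(1) GL_frame_trans[OF frame1] by auto
  then show thesis
    using that m'(2) by blast
qed

lemma pair_val_literals:
  assumes "(m, n) \<in> pairs"
  shows "p \<notin> P \<Longrightarrow> pair_val (m, n) p \<Longrightarrow> V2 n p" and "p \<notin> Q \<Longrightarrow> V2 n p \<Longrightarrow> pair_val (m, n) p"
    and "p \<in> vpos \<phi> \<Longrightarrow> V1 m p \<Longrightarrow> pair_val (m, n) p"
    and "p \<in> vneg \<phi> \<Longrightarrow> pair_val (m, n) p \<Longrightarrow> V1 m p"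
proof -
  have le: "layer_le ls (2 * rank m) m n"
    using assms unfolding pairs_def by auto
  show "p \<notin> P \<Longrightarrow> pair_val (m, n) p \<Longrightarrow> V2 n p"
    using layer_le_literals[OF le pos_literal] unfolding pair_val_def by auto
  show "p \<in> vneg \<phi> \<Longrightarrow> pair_val (m, n) p \<Longrightarrow> V1 m p"
    using layer_le_literals[OF le neg_literal] unfolding pair_val_def by auto
qed (auto simp: pair_val_def)

text \<open>The inclusions record the polarity of \<open>\<psi>\<close> inside
  \<open>\<phi>\<close>, and implication swaps the two halves. Boxes true at \<open>m\<close> pass
  to the amalgam by the choice of \<open>pair_rel\<close>, boxes false at \<open>m\<close> by
  \<open>pair_rel_refuting\<close>.\<close>

lemma pair_sat_fst:
  assumes "\<psi> \<in> Sub \<phi>" and "(m, n) \<in> pairs"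
  shows "(vpos \<psi> \<subseteq> vpos \<phi> \<longrightarrow> vneg \<psi> \<subseteq> vneg \<phi> \<longrightarrow>
      sat R1 V1 m \<psi> \<longrightarrow> sat pair_rel pair_val (m, n) \<psi>) \<and>
    (vpos \<psi> \<subseteq> vneg \<phi> \<longrightarrow> vneg \<psi> \<subseteq> vpos \<phi> \<longrightarrow>
      sat pair_rel pair_val (m, n) \<psi> \<longrightarrow> sat R1 V1 m \<psi>)"
  using assms
proof (induction \<psi> arbitrary: m n)
  case (Var p)
  then show ?case
    using pair_val_literals by auto
next
  case (Imp \<psi> \<chi>)
  have "\<psi> \<in> Sub \<phi>" "\<chi> \<in> Sub \<phi>"
    using Sub_ImpD[OF Imp.prems(1)] by auto
  then show ?case
    using Imp.IH(1)[OF _ Imp.prems(2)] Imp.IH(2)[OF _ Imp.prems(2)] by auto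
next
  case (Box \<psi>)
  have IH: "(vpos \<psi> \<subseteq> vpos \<phi> \<longrightarrow> vneg \<psi> \<subseteq> vneg \<phi> \<longrightarrow>
      sat R1 V1 m' \<psi> \<longrightarrow> sat pair_rel pair_val (m', n') \<psi>) \<and>
    (vpos \<psi> \<subseteq> vneg \<phi> \<longrightarrow> vneg \<psi> \<subseteq> vpos \<phi> \<longrightarrow>
      sat pair_rel pair_val (m', n') \<psi> \<longrightarrow> sat R1 V1 m' \<psi>)"
    if "pair_rel (m, n) (m', n')" for m' n'
    using that Box.IH[OF Sub_BoxD[OF Box.prems(1)]] unfolding pair_rel_def by blast
  have "sat R1 V1 m (Box \<psi>)"
    if "vpos \<psi> \<subseteq> vneg \<phi>" "vneg \<psi> \<subseteq> vpos \<phi>" "sat pair_rel pair_val (m, n) (Box \<psi>)"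
  proof (rule ccontr)
    assume "\<not> ?thesis"
    then obtain m' n' where "pair_rel (m, n) (m', n')" "\<not> sat R1 V1 m' \<psi>"
      using pair_rel_refuting Box.prems by blast
    with IH that show False
      by auto
  qed
  moreover have "sat pair_rel pair_val (m, n) (Box \<psi>)"
    if "vpos \<psi> \<subseteq> vpos \<phi>" "vneg \<psi> \<subseteq> vneg \<phi>" "sat R1 V1 m (Box \<psi>)"
  proof -
    have "sat pair_rel pair_val (m', n') \<psi>" if r: "pair_rel (m, n) (m', n')" for m' n'
    proof -
      have "sat R1 V1 m' \<psi>"
        using r \<open>sat R1 V1 m (Box \<psi>)\<close> Box.prems(1) unfolding pair_rel_def by simp
      then show ?thesis
        using IH[OF r] \<open>vpos \<psi> \<subseteq> vpos \<phi>\<close> \<open>vneg \<psi> \<subseteq> vneg \<phi>\<close> by blast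
    qed
    then show ?thesis
      by auto
  qed
  ultimately show ?case
    by (simp del: sat.simps(4))
qed simp

lemma pair_sat_snd:
  assumes "(m, n) \<in> pairs" and "vpos \<psi> \<inter> P = {}" and "vneg \<psi> \<inter> Q = {}"
    and "sat pair_rel pair_val (m, n) \<psi>"
  shows "sat R2 V2 n \<psi>"
proof -
  \<comment> \<open>With the amalgam as first model, the projection \<open>snd\<close> is a directed
    bisimulation; \<open>pair_rel_back\<close> supplies its backward condition.\<close>
  interpret proj: two_models pair_rel pair_val R2 V2 .
  have "\<exists>n'. R2 n n' \<and> y \<in> pairs \<and> snd y = n'"
    if "x \<in> pairs \<and> snd x = n" "pair_rel x y" for x y n
    using that unfolding pair_rel_def by blast
  moreover have "\<exists>y. pair_rel x y \<and> y \<in> pairs \<and> snd y = n'"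
    if x: "x \<in> pairs \<and> snd x = n" "R2 n n'" for x n n'
  proof -
    have "(fst x, n) \<in> pairs"
      using x(1) by auto
    then obtain m' where "pair_rel (fst x, n) (m', n')"
      using x(2) by (rule pair_rel_back)
    then have "pair_rel x (m', n')" "(m', n') \<in> pairs"
      using x(1) unfolding pair_rel_def by auto
    then show ?thesis
      by (intro exI[of _ "(m', n')"]) simp
  qed
  moreover have "V2 n p" if "x \<in> pairs \<and> snd x = n" "p \<notin> P" "pair_val x p" for x n p
    using pair_val_literals(1)[of "fst x" n p] that by auto
  moreover have "pair_val x p" if "x \<in> pairs \<and> snd x = n" "p \<notin> Q" "V2 n p" for x n p
    using that unfolding pair_val_def by auto
  ultimately show ?thesis
    using proj.directed_bisimulation[of "\<lambda>x n. x \<in> pairs \<and> snd x = n" P Q "(m, n)" n \<psi>] assms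
    by simp
qed

lemma amalgamation:
  assumes "layer_le ls (2 * nbox \<phi> + 1) r w" and "sat R1 V1 r \<phi>" and "\<phi> \<rightarrow>\<^sub>f \<psi> \<in> GL"
    and "vpos \<psi> \<inter> P = {}" and "vneg \<psi> \<inter> Q = {}"
  shows "sat R2 V2 w \<psi>"
proof -
  \<comment> \<open>Ranks never exceed \<open>nbox \<phi>\<close>, so the rounds granted at the root
    suffice for the initial pair.\<close>
  have "(r, w) \<in> pairs"
    using assms(1) rank_le_nbox[of r] by (intro layer_le_imp_pairs) (auto elim: layer_le_antimono)
  moreover from this have "sat pair_rel pair_val (r, w) \<phi>"
    using pair_sat_fst[OF Sub_refl] assms(2) by blast
  moreover from this have "sat pair_rel pair_val (r, w) \<psi>"
    using GL_sound[OF assms(3) GL_frame_pair_rel] by simp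
  ultimately show ?thesis
    using pair_sat_snd assms by blast
qed

end

section \<open>The interpolant\<close>

definition literals :: "form \<Rightarrow> nat set \<Rightarrow> nat set \<Rightarrow> form list" where
  "literals \<phi> P Q = map Var (sorted_list_of_set (vpos \<phi> - P)) @
     map (\<lambda>p. Neg (Var p)) (sorted_list_of_set (vneg \<phi> - Q))"

text \<open>Disjunctions are formed first because a disjunction that does not follow from
  \<open>\<phi>\<close> yields a model of \<open>\<phi>\<close> refuting all its members at once;
  \<open>interpolant_Imp\<close> finds \<open>r\<close> this way.\<close>

definition interpolant :: "form \<Rightarrow> nat set \<Rightarrow> nat set \<Rightarrow> form" where
  "interpolant \<phi> P Q = Conj (filter (\<lambda>\<chi>. \<phi> \<rightarrow>\<^sub>f \<chi> \<in> GL)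
     (map Disj (subseqs (layer (literals \<phi> P Q) (2 * nbox \<phi> + 1)))))"

lemma finite_vpos: "finite (vpos \<phi>)" and finite_vneg: "finite (vneg \<phi>)"
  by (induction \<phi>) auto

lemma set_literals:
  "set (literals \<phi> P Q) = Var ` (vpos \<phi> - P) \<union> (\<lambda>p. Neg (Var p)) ` (vneg \<phi> - Q)"
  by (simp add: literals_def finite_vpos finite_vneg)

lemma interpolant_vars_depth:
  "vpos (interpolant \<phi> P Q) \<subseteq> vpos \<phi> - P" "vneg (interpolant \<phi> P Q) \<subseteq> vneg \<phi> - Q"
  "depth (interpolant \<phi> P Q) \<le> 2 * nbox \<phi> + 1"
proof -
  let ?F = "layer (literals \<phi> P Q) (2 * nbox \<phi> + 1)"
  have F: "vpos \<chi> \<subseteq> vpos \<phi> - P \<and> vneg \<chi> \<subseteq> vneg \<phi> - Q \<and> depth \<chi> \<le> 2 * nbox \<phi> + 1"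
    if "xs \<in> set (subseqs ?F)" "\<chi> \<in> set xs" for xs \<chi>
    by (rule layer_vars_depth[OF _ subseqs_mem[OF that]]) (auto simp: set_literals)
  then have D: "vpos (Disj xs) \<subseteq> vpos \<phi> - P" "vneg (Disj xs) \<subseteq> vneg \<phi> - Q"
      "depth (Disj xs) \<le> 2 * nbox \<phi> + 1" if "xs \<in> set (subseqs ?F)" for xs
    using that unfolding Disj_simps by blast+
  show "vpos (interpolant \<phi> P Q) \<subseteq> vpos \<phi> - P" "vneg (interpolant \<phi> P Q) \<subseteq> vneg \<phi> - Q"
    "depth (interpolant \<phi> P Q) \<le> 2 * nbox \<phi> + 1"
    unfolding interpolant_def Conj_simps set_filter set_map using D by blast+
qed

lemma Imp_interpolant: "\<phi> \<rightarrow>\<^sub>f interpolant \<phi> P Q \<in> GL"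
proof (rule ccontr)
  assume "\<not> ?thesis"
  then obtain R V and w :: "form set" where R: "GL_frame R" "\<not> sat R V w (\<phi> \<rightarrow>\<^sub>f interpolant \<phi> P Q)"
    by (rule GL_complete)
  then obtain \<chi> where "\<phi> \<rightarrow>\<^sub>f \<chi> \<in> GL" "sat R V w \<phi>" "\<not> sat R V w \<chi>"
    unfolding interpolant_def by (auto simp del: Disj_simps)
  then show False
    using GL_sound[OF _ R(1)] by fastforce
qed

lemma interpolant_Imp:
  assumes "vpos \<psi> \<inter> P = {}" and "vneg \<psi> \<inter> Q = {}" and "\<phi> \<rightarrow>\<^sub>f \<psi> \<in> GL"
  shows "interpolant \<phi> P Q \<rightarrow>\<^sub>f \<psi> \<in> GL"
proof (rule ccontr)
  let ?F = "layer (literals \<phi> P Q) (2 * nbox \<phi> + 1)"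
  assume "\<not> ?thesis"
  then obtain R2 V2 and w :: "form set" where N: "GL_frame R2"
      "\<not> sat R2 V2 w (interpolant \<phi> P Q \<rightarrow>\<^sub>f \<psi>)"
    by (rule GL_complete)
  \<comment> \<open>A point refuting all these formulas is related to \<open>w\<close> by
    \<open>layer_le\<close>.\<close>
  obtain xs where xs: "xs \<in> set (subseqs ?F)" "set xs = {\<chi> \<in> set ?F. \<not> sat R2 V2 w \<chi>}"
    by (rule subseqs_filterE)
  have "\<not> sat R2 V2 w (Disj xs)"
    using xs(2) by simp
  \<comment> \<open>As \<open>w\<close> satisfies the interpolant, a disjunction false at
    \<open>w\<close> is not among its conjuncts.\<close>
  then have "\<phi> \<rightarrow>\<^sub>f Disj xs \<notin> GL"
    using N(2) xs(1) unfolding interpolant_def by (auto simp del: Disj_simps)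
  then obtain R1 V1 and r :: "form set" where M: "GL_frame R1" "\<not> sat R1 V1 r (\<phi> \<rightarrow>\<^sub>f Disj xs)"
    by (rule GL_complete)
  interpret amalgam R1 V1 R2 V2 \<phi> P Q "literals \<phi> P Q"
    by unfold_locales (use M N in \<open>auto simp: set_literals\<close>)
  have "layer_le (literals \<phi> P Q) (2 * nbox \<phi> + 1) r w"
    using M(2) xs(2) unfolding layer_le_def by auto
  then have "sat R2 V2 w \<psi>"
    using amalgamation M(2) assms by auto
  with N(2) show False
    by simp
qed

theorem theorem5p2:
  shows "ULIP GL \<and>
    (\<forall>\<phi> P Q. finite P \<longrightarrow> finite Q \<longrightarrow>
      (\<exists>\<theta>. uniform_Lyndon_interpolant GL \<phi> P Q \<theta> \<and> depth \<theta> \<le> 3 * nbox \<phi> + 3))"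
proof -
  \<comment> \<open>The depth bound obtained, \<open>2 * nbox \<phi> + 1\<close>, lies below
    \<open>3 * nbox \<phi> + 3\<close>.\<close>
  have "uniform_Lyndon_interpolant GL \<phi> P Q (interpolant \<phi> P Q) \<and>
    depth (interpolant \<phi> P Q) \<le> 3 * nbox \<phi> + 3" for \<phi> P Q
    unfolding uniform_Lyndon_interpolant_def
    using interpolant_vars_depth[of \<phi> P Q] Imp_interpolant interpolant_Imp by auto
  then show ?thesis
    unfolding ULIP_def by blast
qed

end
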